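(* Let $\Phi$ be the root system of a split connected reductive affine algebraic group $G$ over a field $K$ relative to a split maximal torus $T$, let $W_\circ$ be its finite Weyl group, and fix a simple system $\Delta\subset\Phi$ with corresponding positive system $\Pi$. For $w\in W_\circ$ put $\mathcal{L}(w)=\{b\in\Pi : w(b)\in-\Pi\}$. Then for all $w\in W_\circ$ and all $a\in\Phi$, $$\sum_{b\in\mathcal{L}(w)}\langle a,b^\vee\rangle=\mathrm{Ht}(a)-\mathrm{Ht}(w(a)).$$
   Context: $b^\vee$ denotes the coroot of $b\in\Phi$ and $\langle\cdot,\cdot\rangle$ the natural pairing between characters and cocharacters. $\mathrm{Ht}:\Phi\to\mathbf{Z}$ is the height function relative to $\Delta=\{\alpha_1,\dots,\alpha_n\}$: $\mathrm{Ht}(\sum_i m_i\alpha_i)=\sum_i m_i$. *)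

theory Defs
  imports Complex_Main "HOL-Algebra.Bij" "HOL-Algebra.Generated_Groups"
begin

text \<open>
  The combinatorial data attached to a split connected reductive group \<open>G\<close> over a field and a split
  maximal torus \<open>T\<close> are formalized as a reduced root datum: \<open>'x\<close> is the character group of \<open>T\<close>,
  \<open>'y\<close> its cocharacter group, \<open>pairing\<close> the natural pairing between them, \<open>\<Phi>\<close> the set of roots
  and \<open>coroot\<close> the bijection from roots to coroots. The Weyl group is represented by its faithful
  action on the character group.
\<close>

definition int_scale :: "int \<Rightarrow> 'a::ab_group_add \<Rightarrow> 'a" where
  "int_scale k x =
     (if 0 \<le> k then (((+) x) ^^ nat k) 0 else - ((((+) x) ^^ nat (- k)) 0))"

lemma int_scale_0 [simp]: "int_scale 0 x = 0"
  by (simp add: int_scale_def)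

lemma int_scale_succ: "int_scale (k + 1) x = x + int_scale k x"
proof -
  consider "0 \<le> k" | "k = - 1" | "k < - 1" by linarith
  then show ?thesis
  proof cases
    case 1
    then have "nat (k + 1) = Suc (nat k)" by simp
    with 1 show ?thesis by (simp add: int_scale_def)
  next
    case 2
    then show ?thesis by (simp add: int_scale_def)
  next
    case 3
    then have "nat (- k) = Suc (nat (- (k + 1)))" by simp
    with 3 show ?thesis unfolding int_scale_def by simp
  qed
qed

lemma int_scale_pred: "int_scale (k - 1) x = int_scale k x - x"
  using int_scale_succ [of "k - 1" x] by simp

lemma int_scale_add_right: "int_scale k (x + y) = int_scale k x + int_scale k y"
  by (induction k rule: int_induct [where k = 0])
    (simp_all add: int_scale_succ int_scale_pred algebra_simps)

lemma int_scale_add_left: "int_scale (k + l) x = int_scale k x + int_scale l x"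
proof (induction k rule: int_induct [where k = 0])
  case (step1 i)
  have "i + 1 + l = (i + l) + 1" by simp
  then have "int_scale (i + 1 + l) x = x + int_scale (i + l) x"
    by (simp only: int_scale_succ)
  with step1 show ?case by (simp add: int_scale_succ add.assoc)
next
  case (step2 i)
  have "i - 1 + l = (i + l) - 1" by simp
  then have "int_scale (i - 1 + l) x = int_scale (i + l) x - x"
    by (simp only: int_scale_pred)
  with step2 show ?case by (simp add: int_scale_pred)
qed simp

lemma int_scale_minus_left: "int_scale (- k) x = - int_scale k x"
  using int_scale_add_left [of k "- k" x] by (simp add: eq_neg_iff_add_eq_0 add.commute)

lemma int_scale_int_scale: "int_scale k (int_scale l x) = int_scale (k * l) x"
proof (induction k rule: int_induct [where k = 0])
  case (step1 i)
  have "(i + 1) * l = l + i * l" by (simp add: algebra_simps)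
  then have "int_scale ((i + 1) * l) x = int_scale l x + int_scale (i * l) x"
    by (simp only: int_scale_add_left)
  with step1 show ?case by (simp add: int_scale_succ)
next
  case (step2 i)
  have "(i - 1) * l = i * l + - l" by (simp add: algebra_simps)
  then have "int_scale ((i - 1) * l) x = int_scale (i * l) x - int_scale l x"
    by (simp only: int_scale_add_left int_scale_minus_left) simp
  with step2 show ?case by (simp add: int_scale_pred)
qed simp

interpretation int_module: module int_scale
proof
  show "int_scale 1 x = x" for x :: 'a
    using int_scale_succ [of 0 x] by simp
qed (simp_all add: int_scale_add_right int_scale_add_left int_scale_int_scale)

definition reflection ::
  "('x::ab_group_add \<Rightarrow> 'y::ab_group_add \<Rightarrow> int) \<Rightarrow> ('x \<Rightarrow> 'y) \<Rightarrow> 'x \<Rightarrow> 'x \<Rightarrow> 'x" where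
  "reflection pairing coroot a x = x - int_scale (pairing x (coroot a)) a"

definition coreflection ::
  "('x::ab_group_add \<Rightarrow> 'y::ab_group_add \<Rightarrow> int) \<Rightarrow> ('x \<Rightarrow> 'y) \<Rightarrow> 'x \<Rightarrow> 'y \<Rightarrow> 'y" where
  "coreflection pairing coroot a y = y - int_scale (pairing a y) (coroot a)"

locale perfect_pairing =
  fixes pairing :: "'x::ab_group_add \<Rightarrow> 'y::ab_group_add \<Rightarrow> int"
  assumes additive_left: "additive (\<lambda>x. pairing x y)"
    and additive_right: "additive (\<lambda>y. pairing x y)"
    and perfect_left: "bij_betw (\<lambda>x y. pairing x y) UNIV {f. additive f}"
    and perfect_right: "bij_betw (\<lambda>y x. pairing x y) UNIV {f. additive f}"

locale root_datum = perfect_pairing pairing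
  for pairing :: "'x::ab_group_add \<Rightarrow> 'y::ab_group_add \<Rightarrow> int" +
  fixes \<Phi> :: "'x set" and coroot :: "'x \<Rightarrow> 'y"
  assumes free_characters:
      "\<exists>B::'x set. finite B \<and> int_module.independent B \<and> int_module.span B = UNIV"
    and free_cocharacters:
      "\<exists>B::'y set. finite B \<and> int_module.independent B \<and> int_module.span B = UNIV"
    and finite_roots: "finite \<Phi>"
    and inj_coroot: "inj_on coroot \<Phi>"
    and pairing_coroot: "a \<in> \<Phi> \<Longrightarrow> pairing a (coroot a) = 2"
    and reflection_roots: "a \<in> \<Phi> \<Longrightarrow> reflection pairing coroot a ` \<Phi> = \<Phi>"
    and coreflection_coroots:
      "a \<in> \<Phi> \<Longrightarrow> coreflection pairing coroot a ` (coroot ` \<Phi>) = coroot ` \<Phi>"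

text \<open>
  Reducedness: the only rational multiples of a root \<open>a\<close> that are roots are \<open>a\<close> and \<open>- a\<close>. The
  relation \<open>b = (m / n) a\<close> is written without denominators.
\<close>

locale reduced_root_datum = root_datum pairing \<Phi> coroot
  for pairing :: "'x::ab_group_add \<Rightarrow> 'y::ab_group_add \<Rightarrow> int"
    and \<Phi> :: "'x set" and coroot :: "'x \<Rightarrow> 'y" +
  assumes reduced:
    "\<lbrakk>a \<in> \<Phi>; b \<in> \<Phi>; n \<noteq> 0; int_scale n b = int_scale m a\<rbrakk> \<Longrightarrow> b = a \<or> b = - a"

definition weyl_group ::
  "('x::ab_group_add \<Rightarrow> 'y::ab_group_add \<Rightarrow> int) \<Rightarrow> 'x set \<Rightarrow> ('x \<Rightarrow> 'y) \<Rightarrow> ('x \<Rightarrow> 'x) set" where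
  "weyl_group pairing \<Phi> coroot = generate (BijGroup UNIV) (reflection pairing coroot ` \<Phi>)"

definition simple_system :: "'x::ab_group_add set \<Rightarrow> 'x set \<Rightarrow> bool" where
  "simple_system \<Phi> \<Delta> \<longleftrightarrow>
     \<Delta> \<subseteq> \<Phi> \<and> int_module.independent \<Delta> \<and>
     (\<forall>a\<in>\<Phi>. \<exists>m. a = (\<Sum>d\<in>\<Delta>. int_scale (m d) d) \<and>
        ((\<forall>d\<in>\<Delta>. 0 \<le> m d) \<or> (\<forall>d\<in>\<Delta>. m d \<le> 0)))"

definition positive_system :: "'x::ab_group_add set \<Rightarrow> 'x set \<Rightarrow> 'x set" where
  "positive_system \<Phi> \<Delta> =
     {a \<in> \<Phi>. \<exists>m. a = (\<Sum>d\<in>\<Delta>. int_scale (m d) d) \<and> (\<forall>d\<in>\<Delta>. 0 \<le> m d)}"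

definition height :: "'x::ab_group_add set \<Rightarrow> 'x \<Rightarrow> int" where
  "height \<Delta> a = (\<Sum>d\<in>\<Delta>. int_module.representation \<Delta> a d)"

definition inversion_set :: "'x::ab_group_add set \<Rightarrow> 'x set \<Rightarrow> ('x \<Rightarrow> 'x) \<Rightarrow> 'x set" where
  "inversion_set \<Phi> \<Delta> w =
     {b \<in> positive_system \<Phi> \<Delta>. w b \<in> uminus ` positive_system \<Phi> \<Delta>}"

lemma height_sum:
  assumes "finite \<Delta>" "int_module.independent \<Delta>"
  shows "height \<Delta> (\<Sum>d\<in>\<Delta>. int_scale (m d) d) = (\<Sum>d\<in>\<Delta>. m d)"
proof -
  have "int_module.representation \<Delta> (\<Sum>d\<in>\<Delta>. int_scale (m d) d) e = m e" if "e \<in> \<Delta>" for e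
  proof -
    have "int_module.representation \<Delta> (\<Sum>d\<in>\<Delta>. int_scale (m d) d) e
        = (\<Sum>d\<in>\<Delta>. int_module.representation \<Delta> (int_scale (m d) d) e)"
      using assms
      by (subst int_module.representation_sum)
        (auto intro: int_module.span_scale int_module.span_base)
    also have "\<dots> = (\<Sum>d\<in>\<Delta>. m d * (if d = e then 1 else 0))"
      using assms
      by (intro sum.cong)
        (auto simp: int_module.representation_scale int_module.span_base
          int_module.representation_basis)
    also have "\<dots> = m e"
      using assms that by (simp add: if_distrib cong: if_cong)
    finally show ?thesis .
  qed
  then show ?thesis by (simp add: height_def)
qed

context root_datum
begin

lemma reflection_reflection:
  assumes "a \<in> \<Phi>"
  shows "reflection pairing coroot a (reflection pairing coroot a x) = x"
proof -
  interpret l: additive "\<lambda>x. pairing x (coroot a)" by (rule additive_left)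
  have scale: "pairing (int_scale k a) (coroot a) = k * 2" for k
    by (induction k rule: int_induct [where k = 0])
      (simp_all add: l.zero l.add l.diff int_scale_succ int_scale_pred pairing_coroot assms)
  show ?thesis
    by (simp add: reflection_def l.diff scale flip: int_module.scale_left_distrib)
qed

lemma reflection_in_BijGroup:
  assumes "a \<in> \<Phi>"
  shows "reflection pairing coroot a \<in> carrier (BijGroup UNIV)"
  using reflection_reflection [OF assms]
  by (auto simp: BijGroup_def Bij_def intro!: o_bij [where g = "reflection pairing coroot a"])

lemma subgroup_weyl_group: "subgroup (weyl_group pairing \<Phi> coroot) (BijGroup UNIV)"
  unfolding weyl_group_def
  by (rule group.generate_is_subgroup [OF group_BijGroup]) (auto intro: reflection_in_BijGroup)

end

end

theory Submission
  imports Defs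
begin

text \<open>
  Let \<open>2\<rho>\<^sup>\<or>\<close> be the sum of the positive coroots. A Weyl group element \<open>w\<close> moves the positive roots
  outside \<open>\<L>(w)\<close> to positive roots and the negatives of the roots in \<open>\<L>(w)\<close> to the remaining ones,
  so invariance of the pairing gives
  \<open>\<langle>w a, 2\<rho>\<^sup>\<or>\<rangle> = \<langle>a, 2\<rho>\<^sup>\<or>\<rangle> - 2 (\<Sum>b\<in>\<L>(w). \<langle>a, b\<^sup>\<or>\<rangle>)\<close>. For the simple reflection in \<open>d\<close> the inversion
  set is \<open>{d}\<close>, and \<open>a = d\<close> yields \<open>\<langle>d, 2\<rho>\<^sup>\<or>\<rangle> = 2\<close>; hence pairing with \<open>2\<rho>\<^sup>\<or>\<close> is twice the height.
\<close>

section \<open>Transvections and reflections preserving a finite set\<close>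

lemma (in additive) int_scale: "f (int_scale k x) = int_scale k (f x)"
  by (induction k rule: int_induct [where k = 0])
    (simp_all add: zero add diff int_scale_succ int_scale_pred)

lemma int_scale_eq_mult: "int_scale k m = k * m" for m :: int
  by (induction k rule: int_induct [where k = 0])
    (simp_all add: int_scale_succ int_scale_pred algebra_simps)

definition transvection :: "('a::ab_group_add \<Rightarrow> int) \<Rightarrow> 'a \<Rightarrow> 'a \<Rightarrow> 'a" where
  "transvection h c x = x + int_scale (h x) c"

lemma transvection_funpow:
  assumes "additive h" "h c = 0"
  shows "(transvection h c ^^ n) x = x + int_scale (int n * h x) c"
proof (induction n)
  case (Suc n)
  interpret h: additive h by fact
  have "(transvection h c ^^ Suc n) x = transvection h c (x + int_scale (int n * h x) c)"
    by (simp add: Suc)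
  also have "\<dots> = x + int_scale (int n * h x + h x) c"
    by (simp add: transvection_def h.add h.int_scale assms(2) int_scale_add_left)
  finally show ?case by (simp add: algebra_simps)
qed simp

lemma transvection_functional_eq_0:
  assumes "additive h" "h c = 0"
    and torsion_free: "inj (\<lambda>k. int_scale k c)"
    and stable: "transvection h c ` R \<subseteq> R"
    and "finite R" "x \<in> R"
  shows "h x = 0"
proof (rule ccontr)
  assume "h x \<noteq> 0"
  then have "inj (\<lambda>n. int n * h x)"
    by (auto intro: injI)
  from inj_compose [OF torsion_free this] have "inj (\<lambda>n. (transvection h c ^^ n) x)"
    by (auto simp: transvection_funpow [OF assms(1,2)] inj_def)
  then have "infinite (range (\<lambda>n. (transvection h c ^^ n) x))"
    using finite_imageD infinite_UNIV_nat by blast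
  moreover have "(transvection h c ^^ n) x \<in> R" for n
    using stable \<open>x \<in> R\<close> by (induction n) auto
  ultimately show False
    using \<open>finite R\<close> by (meson finite_subset image_subsetI)
qed

text \<open>
  The reflections \<open>x \<mapsto> x - f x c\<close> and \<open>x \<mapsto> x - g x c\<close> compose to the transvection along \<open>c\<close>
  given by \<open>g - f\<close>.
\<close>

lemma reflection_functional_unique:
  fixes f g :: "'a::ab_group_add \<Rightarrow> int"
  assumes "additive f" "f c = 2" and stable_f: "\<And>x. x \<in> R \<Longrightarrow> x - int_scale (f x) c \<in> R"
    and "additive g" "g c = 2" and stable_g: "\<And>x. x \<in> R \<Longrightarrow> x - int_scale (g x) c \<in> R"
    and "finite R" "x \<in> R"
  shows "f x = g x"
proof -
  interpret f: additive f by fact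
  interpret g: additive g by fact
  define h where "h y = g y - f y" for y
  have "additive h"
    by unfold_locales (simp add: h_def f.add g.add)
  moreover have "h c = 0"
    by (simp add: h_def \<open>f c = 2\<close> \<open>g c = 2\<close>)
  moreover have "inj (\<lambda>k. int_scale k c)"
  proof (rule injI)
    fix k l
    assume "int_scale k c = int_scale l c"
    then have "f (int_scale k c) = f (int_scale l c)" by simp
    then show "k = l" by (simp add: f.int_scale int_scale_eq_mult \<open>f c = 2\<close>)
  qed
  moreover have "transvection h c ` R \<subseteq> R"
  proof (rule image_subsetI)
    fix y
    assume "y \<in> R"
    define z where "z = y - int_scale (g y) c"
    have "f z = f y - 2 * g y"
      by (simp add: z_def f.diff f.int_scale int_scale_eq_mult \<open>f c = 2\<close>)
    then have "transvection h c y = z - int_scale (f z) c"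
      by (simp add: z_def transvection_def h_def algebra_simps
          flip: int_module.scale_left_distrib)
    also have "\<dots> \<in> R"
      unfolding z_def using \<open>y \<in> R\<close> by (intro stable_f stable_g)
    finally show "transvection h c y \<in> R" .
  qed
  ultimately have "h x = 0"
    using \<open>finite R\<close> \<open>x \<in> R\<close> by (rule transvection_functional_eq_0)
  then show ?thesis by (simp add: h_def)
qed

section \<open>Root automorphisms\<close>

definition root_automorphisms :: "'x::ab_group_add set \<Rightarrow> ('x \<Rightarrow> 'x) set" where
  "root_automorphisms \<Phi> = {w. additive w \<and> bij w \<and> w ` \<Phi> = \<Phi>}"

lemma root_automorphisms_mem_iff: "w \<in> root_automorphisms \<Phi> \<Longrightarrow> w a \<in> \<Phi> \<longleftrightarrow> a \<in> \<Phi>"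
  using inj_image_mem_iff [of w a \<Phi>] by (simp add: root_automorphisms_def bij_is_inj)

lemma inv_into_in_root_automorphisms:
  assumes "w \<in> root_automorphisms \<Phi>"
  shows "inv_into UNIV w \<in> root_automorphisms \<Phi>"
proof -
  have w: "additive w" "bij w" "w ` \<Phi> = \<Phi>"
    using assms by (simp_all add: root_automorphisms_def)
  interpret w: additive w by fact
  have "inv_into UNIV w (x + y) = inv_into UNIV w x + inv_into UNIV w y" for x y
    by (rule inv_f_eq) (simp_all add: w.add w(2) bij_is_inj bij_is_surj surj_f_inv_f)
  moreover have "inv_into UNIV w ` \<Phi> = \<Phi>"
    using image_inv_f_f [OF bij_is_inj [OF w(2)], of \<Phi>] w(3) by simp
  ultimately show ?thesis
    using w(2) by (simp add: root_automorphisms_def additive_def bij_imp_bij_inv)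
qed

lemma subgroup_root_automorphisms: "subgroup (root_automorphisms \<Phi>) (BijGroup UNIV)"
proof
  have Bij_UNIV: "Bij UNIV = {w :: 'a \<Rightarrow> 'a. bij w}"
    by (auto simp: Bij_def)
  show "root_automorphisms \<Phi> \<subseteq> carrier (BijGroup UNIV)"
    by (auto simp: BijGroup_def Bij_UNIV root_automorphisms_def)
  show "\<one>\<^bsub>BijGroup UNIV\<^esub> \<in> root_automorphisms \<Phi>"
    by (auto simp: BijGroup_def root_automorphisms_def additive_def simp flip: id_def)
  fix w
  assume w: "w \<in> root_automorphisms \<Phi>"
  then have "w \<in> Bij UNIV"
    by (simp add: Bij_UNIV root_automorphisms_def)
  then show "inv\<^bsub>BijGroup UNIV\<^esub> w \<in> root_automorphisms \<Phi>"
    using inv_into_in_root_automorphisms [OF w] by (simp add: inv_BijGroup restrict_UNIV)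
  fix v
  assume v: "v \<in> root_automorphisms \<Phi>"
  then have "(v \<circ> w) ` \<Phi> = \<Phi>"
    using w unfolding image_comp [symmetric] by (simp add: root_automorphisms_def)
  then have "v \<circ> w \<in> root_automorphisms \<Phi>"
    using v w by (simp add: root_automorphisms_def additive_def bij_comp)
  moreover have "v \<otimes>\<^bsub>BijGroup UNIV\<^esub> w = v \<circ> w"
    using v w by (auto simp: BijGroup_def Bij_UNIV compose_def root_automorphisms_def)
  ultimately show "v \<otimes>\<^bsub>BijGroup UNIV\<^esub> w \<in> root_automorphisms \<Phi>" by simp
qed

sublocale perfect_pairing \<subseteq> pairing_left: additive "\<lambda>x. pairing x y" for y
  by (rule additive_left)

context root_datum
begin

abbreviation \<sigma> :: "'x \<Rightarrow> 'x \<Rightarrow> 'x" where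
  "\<sigma> \<equiv> reflection pairing coroot"

lemma reflection_self:
  assumes "a \<in> \<Phi>"
  shows "\<sigma> a a = - a"
proof -
  have "\<sigma> a a = a - int_scale (1 + 1) a"
    by (simp add: reflection_def pairing_coroot assms)
  also have "\<dots> = - a"
    by (simp only: int_scale_add_left int_module.scale_one) simp
  finally show ?thesis .
qed

lemma uminus_root: "a \<in> \<Phi> \<Longrightarrow> - a \<in> \<Phi>"
  using reflection_roots reflection_self by (metis imageI)

lemma zero_not_root: "0 \<notin> \<Phi>"
  using pairing_coroot pairing_left.zero by force

lemma reflection_in_root_automorphisms:
  assumes "a \<in> \<Phi>"
  shows "\<sigma> a \<in> root_automorphisms \<Phi>"
proof -
  have "additive (\<sigma> a)"
    by unfold_locales (simp add: reflection_def pairing_left.add int_scale_add_left)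
  moreover have "bij (\<sigma> a)"
    using reflection_reflection [OF assms] by (intro o_bij [of "\<sigma> a"]) auto
  ultimately show ?thesis
    using reflection_roots [OF assms] by (simp add: root_automorphisms_def)
qed

lemma uminus_in_root_automorphisms: "uminus \<in> root_automorphisms \<Phi>"
  using uminus_root
  by (force simp: root_automorphisms_def additive_def bij_uminus image_iff)

lemma weyl_group_subset_root_automorphisms:
  "weyl_group pairing \<Phi> coroot \<subseteq> root_automorphisms \<Phi>"
  unfolding weyl_group_def
  using group.generate_subgroup_incl [OF group_BijGroup _ subgroup_root_automorphisms]
    reflection_in_root_automorphisms by blast

lemma pairing_root_automorphism:
  assumes w: "w \<in> root_automorphisms \<Phi>" and a: "a \<in> \<Phi>" and b: "b \<in> \<Phi>"
  shows "pairing (w a) (coroot (w b)) = pairing a (coroot b)"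
proof (rule reflection_functional_unique [OF _ _ _ _ _ _ finite_roots a])
  interpret w: additive w
    using w by (simp add: root_automorphisms_def)
  show "additive (\<lambda>x. pairing x (coroot b))"
    by (rule additive_left)
  show "additive (\<lambda>x. pairing (w x) (coroot (w b)))"
    by unfold_locales (simp add: w.add pairing_left.add)
  show "pairing b (coroot b) = 2" "pairing (w b) (coroot (w b)) = 2"
    using w b by (simp_all add: pairing_coroot root_automorphisms_mem_iff)
  show "x - int_scale (pairing x (coroot b)) b \<in> \<Phi>" if "x \<in> \<Phi>" for x
    using reflection_roots [OF b] that by (auto simp: reflection_def)
  show "x - int_scale (pairing (w x) (coroot (w b))) b \<in> \<Phi>" if "x \<in> \<Phi>" for x
  proof -
    have "w (x - int_scale (pairing (w x) (coroot (w b))) b) = \<sigma> (w b) (w x)"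
      by (simp add: reflection_def w.diff w.int_scale)
    also have "\<dots> \<in> \<Phi>"
      by (simp add: root_automorphisms_mem_iff reflection_in_root_automorphisms w b that)
    finally show ?thesis
      using w by (simp add: root_automorphisms_mem_iff)
  qed
qed

lemma pairing_coroot_uminus:
  assumes "a \<in> \<Phi>" "b \<in> \<Phi>"
  shows "pairing a (coroot (- b)) = - pairing a (coroot b)"
  using pairing_root_automorphism [OF uminus_in_root_automorphisms assms]
  by (simp add: pairing_left.minus)

end

section \<open>Positive roots\<close>

lemma (in module) representation_sum_scale:
  assumes "independent B" "finite B" "b \<in> B"
  shows "representation B (\<Sum>e\<in>B. m e *s e) b = m b"
proof -
  have "representation B (\<Sum>e\<in>B. m e *s e) b = (\<Sum>e\<in>B. m e * (if b = e then 1 else 0))"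
    using assms
    by (simp add: representation_sum representation_scale representation_basis span_scale span_base)
  also have "\<dots> = m b"
    using assms by (simp add: if_distrib cong: if_cong)
  finally show ?thesis .
qed

locale based_root_datum = root_datum pairing \<Phi> coroot
  for pairing :: "'x::ab_group_add \<Rightarrow> 'y::ab_group_add \<Rightarrow> int"
    and \<Phi> :: "'x set" and coroot :: "'x \<Rightarrow> 'y" +
  fixes \<Delta> :: "'x set"
  assumes simple_system: "simple_system \<Phi> \<Delta>"
begin

abbreviation Pos :: "'x set" where
  "Pos \<equiv> positive_system \<Phi> \<Delta>"

abbreviation coord :: "'x \<Rightarrow> 'x \<Rightarrow> int" where
  "coord \<equiv> int_module.representation \<Delta>"

lemma simple_roots: "\<Delta> \<subseteq> \<Phi>" and independent_simple: "int_module.independent \<Delta>"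
  using simple_system by (auto simp: simple_system_def)

lemma finite_simple: "finite \<Delta>"
  using simple_roots finite_roots finite_subset by blast

lemma positive_roots: "Pos \<subseteq> \<Phi>"
  by (auto simp: positive_system_def)

lemma finite_positive: "finite Pos"
  using positive_roots finite_roots finite_subset by blast

lemma root_in_span_simple:
  assumes "a \<in> \<Phi>"
  shows "a \<in> int_module.span \<Delta>"
proof -
  obtain m where "a = (\<Sum>d\<in>\<Delta>. int_scale (m d) d)"
    using simple_system assms unfolding simple_system_def by blast
  then show ?thesis
    by (simp add: int_module.span_sum int_module.span_scale int_module.span_base)
qed

lemma sum_coord_eq: "a \<in> \<Phi> \<Longrightarrow> (\<Sum>d\<in>\<Delta>. int_scale (coord a d) d) = a"
  by (simp add: int_module.sum_representation_eq independent_simple root_in_span_simple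
      finite_simple)

lemma coord_sum: "d \<in> \<Delta> \<Longrightarrow> coord (\<Sum>e\<in>\<Delta>. int_scale (m e) e) d = m d"
  by (rule int_module.representation_sum_scale [OF independent_simple finite_simple])

lemma coord_uminus: "a \<in> \<Phi> \<Longrightarrow> coord (- a) d = - coord a d"
  by (simp add: int_module.representation_neg independent_simple root_in_span_simple)

lemma coord_same_sign:
  assumes "a \<in> \<Phi>"
  shows "(\<forall>d\<in>\<Delta>. 0 \<le> coord a d) \<or> (\<forall>d\<in>\<Delta>. coord a d \<le> 0)"
proof -
  obtain m where "a = (\<Sum>d\<in>\<Delta>. int_scale (m d) d)"
    and "(\<forall>d\<in>\<Delta>. 0 \<le> m d) \<or> (\<forall>d\<in>\<Delta>. m d \<le> 0)"
    using simple_system assms unfolding simple_system_def by blast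
  then show ?thesis by (simp add: coord_sum)
qed

lemma positive_iff_coord_nonneg:
  assumes "a \<in> \<Phi>"
  shows "a \<in> Pos \<longleftrightarrow> (\<forall>d\<in>\<Delta>. 0 \<le> coord a d)"
  using sum_coord_eq [OF assms] assms
  by (auto simp: positive_system_def coord_sum) metis

lemma uminus_positive_iff:
  assumes "a \<in> \<Phi>"
  shows "- a \<in> Pos \<longleftrightarrow> a \<notin> Pos"
proof -
  have "\<exists>d\<in>\<Delta>. coord a d \<noteq> 0"
    using sum_coord_eq [OF assms] zero_not_root assms
    by (metis (no_types, lifting) int_scale_0 sum.neutral)
  then show ?thesis
    using coord_same_sign [OF assms]
    by (force simp: positive_iff_coord_nonneg coord_uminus assms uminus_root)
qed

lemma positive_if_coord_pos:
  assumes "a \<in> \<Phi>" "d \<in> \<Delta>" "0 < coord a d"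
  shows "a \<in> Pos"
  using assms coord_same_sign [of a] by (force simp: positive_iff_coord_nonneg)

lemma simple_positive: "d \<in> \<Delta> \<Longrightarrow> d \<in> Pos"
  using simple_roots
  by (auto intro!: positive_if_coord_pos
      simp: int_module.representation_basis independent_simple)

lemma inversion_set_iff:
  assumes "w \<in> root_automorphisms \<Phi>"
  shows "b \<in> inversion_set \<Phi> \<Delta> w \<longleftrightarrow> b \<in> Pos \<and> w b \<notin> Pos"
proof -
  have "w b \<in> uminus ` Pos \<longleftrightarrow> w b \<notin> Pos" if "b \<in> Pos"
    using uminus_positive_iff [of "w b"] root_automorphisms_mem_iff [OF assms] positive_roots that
    by (force simp: image_iff)
  then show ?thesis by (auto simp: inversion_set_def)
qed

lemma vimage_positive:
  assumes w: "w \<in> root_automorphisms \<Phi>"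
  shows "w -` Pos = (Pos - inversion_set \<Phi> \<Delta> w) \<union> uminus ` inversion_set \<Phi> \<Delta> w"
proof -
  interpret w: additive w
    using w by (simp add: root_automorphisms_def)
  show ?thesis
  proof (rule Set.set_eqI)
    fix b
    have uminus_image: "b \<in> uminus ` inversion_set \<Phi> \<Delta> w \<longleftrightarrow> - b \<in> inversion_set \<Phi> \<Delta> w"
      by (force simp: image_iff)
    show "b \<in> w -` Pos \<longleftrightarrow> b \<in> (Pos - inversion_set \<Phi> \<Delta> w) \<union> uminus ` inversion_set \<Phi> \<Delta> w"
    proof (cases "b \<in> \<Phi>")
      case True
      moreover from True have "w b \<in> \<Phi>"
        using w by (simp add: root_automorphisms_mem_iff)
      ultimately show ?thesis
        by (simp add: uminus_image inversion_set_iff [OF w] w.minus uminus_positive_iff) blast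
    next
      case False
      then have "w b \<notin> \<Phi>"
        using w by (simp add: root_automorphisms_mem_iff)
      with False show ?thesis
        using positive_roots uminus_root [of "- b"]
        by (auto simp: uminus_image inversion_set_iff [OF w])
    qed
  qed
qed

definition positive_coroot_sum :: 'y where
  "positive_coroot_sum = (\<Sum>b\<in>Pos. coroot b)"

lemma pairing_positive_coroot_sum:
  "pairing x positive_coroot_sum = (\<Sum>b\<in>Pos. pairing x (coroot b))"
  unfolding positive_coroot_sum_def by (rule additive.sum [OF additive_right])

lemma pairing_positive_coroot_sum_automorphism:
  assumes w: "w \<in> root_automorphisms \<Phi>" and a: "a \<in> \<Phi>"
  shows "pairing (w a) positive_coroot_sum
    = pairing a positive_coroot_sum - 2 * (\<Sum>b\<in>inversion_set \<Phi> \<Delta> w. pairing a (coroot b))"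
proof -
  let ?L = "inversion_set \<Phi> \<Delta> w" and ?p = "\<lambda>b. pairing a (coroot b)"
  have inj: "inj w" and surj: "surj w"
    using w by (auto simp: root_automorphisms_def bij_is_inj bij_is_surj)
  have inversion_set: "?L \<subseteq> Pos" "finite ?L"
    using finite_positive by (auto simp: inversion_set_def)
  have "pairing (w a) positive_coroot_sum = (\<Sum>b\<in>w ` (w -` Pos). pairing (w a) (coroot b))"
    by (simp only: pairing_positive_coroot_sum surj_image_vimage_eq [OF surj])
  also have "\<dots> = (\<Sum>b\<in>w -` Pos. pairing (w a) (coroot (w b)))"
    by (simp add: sum.reindex [OF inj_on_subset [OF inj subset_UNIV]] del: image_vimage_eq)
  also have "\<dots> = (\<Sum>b\<in>w -` Pos. ?p b)"
    using positive_roots root_automorphisms_mem_iff [OF w]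
    by (intro sum.cong refl pairing_root_automorphism [OF w a]) auto
  also have "\<dots> = (\<Sum>b\<in>Pos - ?L. ?p b) + (\<Sum>b\<in>uminus ` ?L. ?p b)"
    unfolding vimage_positive [OF w]
    using finite_positive inversion_set positive_roots uminus_positive_iff
    by (intro sum.union_disjoint) auto
  also have "(\<Sum>b\<in>Pos - ?L. ?p b) = pairing a positive_coroot_sum - (\<Sum>b\<in>?L. ?p b)"
    by (simp add: pairing_positive_coroot_sum sum_diff finite_positive inversion_set)
  also have "(\<Sum>b\<in>uminus ` ?L. ?p b) = (\<Sum>b\<in>?L. - ?p b)"
    using positive_roots inversion_set a
    by (subst sum.reindex) (auto simp: pairing_coroot_uminus subset_iff intro!: sum.cong)
  finally show ?thesis by (simp add: sum_negf)
qed

end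

section \<open>Simple reflections and the height\<close>

locale reduced_based_root_datum =
  based_root_datum pairing \<Phi> coroot \<Delta> + reduced_root_datum pairing \<Phi> coroot
  for pairing :: "'x::ab_group_add \<Rightarrow> 'y::ab_group_add \<Rightarrow> int"
    and \<Phi> :: "'x set" and coroot :: "'x \<Rightarrow> 'y" and \<Delta> :: "'x set"
begin

lemma positive_nonsimple_coord_pos:
  assumes d: "d \<in> \<Delta>" and b: "b \<in> Pos" "b \<noteq> d"
  obtains e where "e \<in> \<Delta>" "e \<noteq> d" "0 < coord b e"
proof -
  have roots: "d \<in> \<Phi>" "b \<in> \<Phi>"
    using d b simple_roots positive_roots by auto
  have "\<exists>e\<in>\<Delta> - {d}. coord b e \<noteq> 0"
  proof (rule ccontr)
    assume "\<not> ?thesis"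
    then have "int_scale 1 b = int_scale (coord b d) d"
      using sum_coord_eq [OF roots(2)] d
      by (simp add: sum.remove [OF finite_simple d])
    then have "b = - d"
      using reduced [OF roots, of 1 "coord b d"] b(2) by simp
    then show False
      using uminus_positive_iff simple_positive d roots b(1) by auto
  qed
  then show thesis
    using that b(1) positive_iff_coord_nonneg [OF roots(2)] by force
qed

lemma reflection_simple_positive:
  assumes d: "d \<in> \<Delta>" and b: "b \<in> Pos" "b \<noteq> d"
  shows "\<sigma> d b \<in> Pos"
proof -
  obtain e where e: "e \<in> \<Delta>" "e \<noteq> d" "0 < coord b e"
    using positive_nonsimple_coord_pos [OF assms] .
  have roots: "d \<in> \<Phi>" "b \<in> \<Phi>"
    using d b simple_roots positive_roots by auto
  then have "coord (\<sigma> d b) e = coord b e"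
    using d e(2)
    by (simp add: reflection_def int_module.representation_diff int_module.representation_scale
        int_module.representation_basis int_module.span_scale independent_simple
        root_in_span_simple)
  then show ?thesis
    using positive_if_coord_pos e reflection_in_root_automorphisms roots
    by (simp add: root_automorphisms_mem_iff)
qed

lemma inversion_set_simple_reflection:
  assumes "d \<in> \<Delta>"
  shows "inversion_set \<Phi> \<Delta> (\<sigma> d) = {d}"
proof -
  have d: "d \<in> \<Phi>" "d \<in> Pos"
    using assms simple_roots simple_positive by auto
  then have "\<sigma> d d \<notin> Pos"
    by (simp add: reflection_self uminus_positive_iff)
  then show ?thesis
    using reflection_simple_positive [OF assms] d
    by (simp add: Set.set_eq_iff inversion_set_iff reflection_in_root_automorphisms) metis
qed

lemma pairing_positive_coroot_sum_simple:
  assumes "d \<in> \<Delta>"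
  shows "pairing d positive_coroot_sum = 2"
proof -
  have d: "d \<in> \<Phi>"
    using assms simple_roots by blast
  have "- pairing d positive_coroot_sum = pairing (\<sigma> d d) positive_coroot_sum"
    by (simp add: reflection_self d pairing_left.minus)
  also have "\<dots> = pairing d positive_coroot_sum - 2 * 2"
    using pairing_positive_coroot_sum_automorphism [OF reflection_in_root_automorphisms [OF d] d]
    by (simp add: inversion_set_simple_reflection assms pairing_coroot d)
  finally show ?thesis by simp
qed

lemma pairing_positive_coroot_sum_eq_height:
  assumes "a \<in> \<Phi>"
  shows "pairing a positive_coroot_sum = 2 * height \<Delta> a"
proof -
  have "pairing a positive_coroot_sum
      = pairing (\<Sum>d\<in>\<Delta>. int_scale (coord a d) d) positive_coroot_sum"
    by (simp add: sum_coord_eq assms)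
  also have "\<dots> = (\<Sum>d\<in>\<Delta>. coord a d * 2)"
    by (simp add: pairing_left.sum pairing_left.int_scale int_scale_eq_mult
        pairing_positive_coroot_sum_simple)
  also have "\<dots> = 2 * height \<Delta> a"
    by (simp add: height_def sum_distrib_left mult.commute)
  finally show ?thesis .
qed

lemma sum_pairing_coroot_inversion_set:
  assumes w: "w \<in> root_automorphisms \<Phi>" and a: "a \<in> \<Phi>"
  shows "(\<Sum>b\<in>inversion_set \<Phi> \<Delta> w. pairing a (coroot b)) = height \<Delta> a - height \<Delta> (w a)"
proof -
  have "2 * height \<Delta> (w a) = pairing (w a) positive_coroot_sum"
    using w a by (simp add: pairing_positive_coroot_sum_eq_height root_automorphisms_mem_iff)
  also have "\<dots> = pairing a positive_coroot_sum
      - 2 * (\<Sum>b\<in>inversion_set \<Phi> \<Delta> w. pairing a (coroot b))"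
    using w a by (rule pairing_positive_coroot_sum_automorphism)
  also have "pairing a positive_coroot_sum = 2 * height \<Delta> a"
    using a by (rule pairing_positive_coroot_sum_eq_height)
  finally show ?thesis by simp
qed

end

theorem proposition3p2p1:
  fixes pairing :: "'x::ab_group_add \<Rightarrow> 'y::ab_group_add \<Rightarrow> int"
    and \<Phi> \<Delta> :: "'x set" and coroot :: "'x \<Rightarrow> 'y"
    and w :: "'x \<Rightarrow> 'x" and a :: 'x
  assumes "reduced_root_datum pairing \<Phi> coroot"
    and "simple_system \<Phi> \<Delta>"
    and "w \<in> weyl_group pairing \<Phi> coroot"
    and "a \<in> \<Phi>"
  shows "(\<Sum>b\<in>inversion_set \<Phi> \<Delta> w. pairing a (coroot b)) = height \<Delta> a - height \<Delta> (w a)"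
proof -
  interpret reduced_root_datum pairing \<Phi> coroot by fact
  interpret reduced_based_root_datum pairing \<Phi> coroot \<Delta>
    by unfold_locales fact
  have "w \<in> root_automorphisms \<Phi>"
    using assms(3) weyl_group_subset_root_automorphisms by blast
  then show ?thesis
    using assms(4) by (rule sum_pairing_coroot_inversion_set)
qed

end
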